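(* Let $n\geq 1$, let $I\times V\times W$ be an open neighborhood of a point $(t_0,x_0,y_0)$ in $\mathbb{R}\times\mathbb{R}^n\times\mathbb{R}^n$ (with $I\subset\mathbb{R}$ and $V,W\subset\mathbb{R}^n$ open), and let $F:I\times V\times W\to\mathbb{R}^n$ be a continuous map with $F(t_0,x_0,y_0)=0$. Suppose that, for all $(t,x)\in I\times V$, the map $W\to\mathbb{R}^n$, $y\mapsto F(t,x,y)$, is differentiable (but not necessarily $C^1$) and without critical points. Then the differential equation $$F(t,x,x')=0,\quad x(t_0)=x_0,\quad x'(t_0)=y_0$$ has a solution in some interval $(t_0-\varepsilon,t_0+\varepsilon)$ with $\varepsilon>0$.
   Context: A map from an open subset of $\mathbb{R}^n$ to $\mathbb{R}^n$ is differentiable if it is (Fréchet) differentiable at every point; a critical point of such a map is a point at which the derivative is not invertible. A solution of the differential equation on $(t_0-\varepsilon,t_0+\varepsilon)$ is a differentiable function $x:(t_0-\varepsilon,t_0+\varepsilon)\to\mathbb{R}^n$ such that $(t,x(t),x'(t))\in I\times V\times W$ and $F(t,x(t),x'(t))=0$ for all $t$ in the interval, with $x(t_0)=x_0$ and $x'(t_0)=y_0$. *)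

theory Defs
  imports "HOL-Analysis.Analysis"
begin

(* Meant for a map f on an open set W that is differentiable at y: the Frechet derivative of f at y
   is then unique and depends only on the values of f on W. A linear map of R^n to itself is
   invertible iff it is bijective (the inverse is automatically linear). *)
definition critical_point_on :: "(real ^ 'n \<Rightarrow> real ^ 'n) \<Rightarrow> (real ^ 'n) set \<Rightarrow> real ^ 'n \<Rightarrow> bool"
  where "critical_point_on f W y \<longleftrightarrow> y \<in> W \<and> \<not> bij (frechet_derivative f (at y))"

(* F and x are total functions; only the values of F on I \<times> V \<times> W and of x on the open interval
   (t0 - \<epsilon>, t0 + \<epsilon>) matter. *)
definition implicit_ode_solution ::
    "(real \<times> (real ^ 'n) \<times> (real ^ 'n) \<Rightarrow> real ^ 'n) \<Rightarrow> real set \<Rightarrow> (real ^ 'n) set \<Rightarrow> (real ^ 'n) set \<Rightarrow>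
     real \<Rightarrow> real ^ 'n \<Rightarrow> real ^ 'n \<Rightarrow> real \<Rightarrow> (real \<Rightarrow> real ^ 'n) \<Rightarrow> bool"
  where "implicit_ode_solution F I V W t0 x0 y0 \<epsilon> x \<longleftrightarrow>
    (\<forall>t \<in> {t0 - \<epsilon> <..< t0 + \<epsilon>}.
        x differentiable (at t) \<and>
        (t, x t, vector_derivative x (at t)) \<in> I \<times> V \<times> W \<and>
        F (t, x t, vector_derivative x (at t)) = 0) \<and>
    x t0 = x0 \<and> vector_derivative x (at t0) = y0"

end

theory Submission
  imports Defs "HOL-Complex_Analysis.Great_Picard"
begin

text \<open>
  Solving the equation for the derivative turns it into an explicit equation with a continuous
  right-hand side, to which Peano's theorem applies. Near \<open>y0\<close> this can be done in a unique and
  continuous way because an everywhere differentiable map of a Euclidean space with injective derivatives is locally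
  injective, although it need not be \<open>C\<^sup>1\<close>. Indeed, if the closed set \<open>E\<close> of points without an
  injective neighbourhood were nonempty, then by Baire some ball around a point of \<open>E\<close> would carry a
  uniform bound \<open>|f b - f a| \<ge> c |b - a|\<close> for \<open>a \<in> E\<close>, so that values at points of \<open>E\<close>
  are taken only once there. The set \<open>A\<close> of values taken at least twice is open with frontier in
  \<open>f ` E\<close>. Take a ball in \<open>A\<close> touching the frontier at \<open>f e\<close>. Over a ball in \<open>A\<close> the map is a
  covering, hence injective on connected sets; but close to \<open>e\<close> it is almost linear, so both
  preimages of a point of the touching ball near \<open>f e\<close> lie in a common convex set over
  such a ball, a contradiction.
\<close>

subsection \<open>Proper locally injective maps\<close>

text \<open>Each fibre is compact because \<open>K\<close> is, and discrete by local injectivity,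
  hence finite. Disjoint injective neighbourhoods of its points have open images by invariance of
  domain, and a small open set inside all these images is evenly covered.\<close>

lemma proper_local_injection_covering:
  fixes f :: "'a::euclidean_space \<Rightarrow> 'a"
  assumes K: "compact K" "continuous_on K f"
    and D: "open D" "connected D"
    and U: "open (K \<inter> f -` D)" "K \<inter> f -` D \<noteq> {}"
    and inj: "\<And>y. y \<in> K \<inter> f -` D \<Longrightarrow> \<exists>N. open N \<and> y \<in> N \<and> inj_on f N"
  shows "covering_space (K \<inter> f -` D) f D"
proof
  define U where "U = K \<inter> f -` D"
  have oU: "open U" and U_sub: "U \<subseteq> K" using U unfolding U_def by auto
  have cU: "continuous_on U f" using K(2) U_sub continuous_on_subset by blast
  have inj': "\<exists>N. open N \<and> y \<in> N \<and> N \<subseteq> U \<and> inj_on f N" if y: "y \<in> U" for y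
  proof -
    obtain N where "open N" "y \<in> N" "inj_on f N" using inj y unfolding U_def by blast
    then show ?thesis using oU y by (intro exI[of _ "N \<inter> U"]) (auto intro: inj_on_subset)
  qed
  have clf: "closed (f ` S)" if "closed S" "S \<subseteq> K" for S
    using that K by (metis closed_Int_compact compact_continuous_image compact_imp_closed continuous_on_subset inf.absorb_iff1)
  have opn: "open (f ` N)" if "open N" "N \<subseteq> U" "inj_on f N" for N
    using invariance_of_domain[of N f] that cU continuous_on_subset by blast
  show "continuous_on (K \<inter> f -` D) f" using cU U_def by simp
  show im: "f ` (K \<inter> f -` D) = D"
  proof -
    \<comment> \<open>Surjectivity: the image is nonempty, open by invariance of domain and
      relatively closed by compactness of \<open>K\<close>, while \<open>D\<close> is
      connected.\<close>
    have eq: "f ` U = f ` K \<inter> D" unfolding U_def by auto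
    have "open (f ` U)"
      unfolding open_subopen[of "f ` U"]
    proof clarify
      fix y assume "y \<in> U"
      then obtain N where "open N" "y \<in> N" "N \<subseteq> U" "inj_on f N" using inj' by blast
      then show "\<exists>T. open T \<and> f y \<in> T \<and> T \<subseteq> f ` U" using opn by (intro exI[of _ "f ` N"]) auto
    qed
    then have "openin (top_of_set D) (f ` U)"
      by (metis Int_lower2 eq openin_open_eq D(1))
    moreover have "closedin (top_of_set D) (f ` U)"
      unfolding eq using clf[of K] K(1) by (simp add: closedin_closed_Int compact_imp_closed inf_commute)
    ultimately show ?thesis
      using D(2) U(2) unfolding connected_clopen U_def by blast
  qed
  fix p assume p: "p \<in> D"
  define P where "P = K \<inter> f -` {p}"
  have PU: "P \<subseteq> U" using p unfolding P_def U_def by auto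
  have P_cpt: "compact P"
  proof -
    have "closed P" unfolding P_def
      using K by (intro continuous_closed_preimage) (auto intro: compact_imp_closed)
    then show ?thesis using K(1) unfolding P_def
      by (metis compact_Int_closed inf.left_idem)
  qed
  have "\<exists>N. \<forall>y\<in>P. open (N y) \<and> y \<in> N y \<and> N y \<subseteq> U \<and> inj_on f (N y)"
    by (intro bchoice) (use inj' PU in blast)
  then obtain N where N: "\<And>y. y \<in> P \<Longrightarrow> open (N y) \<and> y \<in> N y \<and> N y \<subseteq> U \<and> inj_on f (N y)" by blast
  have single: "z = y" if "y \<in> P" "z \<in> P" "z \<in> N y" for y z
    using N[OF that(1)] that unfolding P_def inj_on_def by auto
  have finP: "finite P"
  proof -
    obtain Q where Q: "Q \<subseteq> P" "finite Q" "P \<subseteq> (\<Union>y\<in>Q. N y)"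
      using compactE_image[OF P_cpt, of P N] N by blast
    have "P \<subseteq> Q" using Q single by blast
    then show ?thesis using Q(2) finite_subset by blast
  qed
  \<comment> \<open>cutting down to Voronoi cells makes the neighbourhoods disjoint\<close>
  define M where "M y = N y \<inter> (\<Inter>y'\<in>P - {y}. {z. dist z y < dist z y'})" for y
  have M: "open (M y)" "y \<in> M y" "M y \<subseteq> U" "inj_on f (M y)" if y: "y \<in> P" for y
  proof -
    have "open {z. dist z y < dist z y'}" for y'
      by (intro open_Collect_less continuous_intros)
    then have "open (\<Inter>y'\<in>P - {y}. {z. dist z y < dist z y'})" using finP by (intro open_INT) auto
    then show "open (M y)" unfolding M_def using N[OF y] by blast
  qed (use N[OF y] in \<open>auto simp: M_def intro: inj_on_subset\<close>)
  have M_disj: "M y \<inter> M y' = {}" if "y \<in> P" "y' \<in> P" "y \<noteq> y'" for y y'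
  proof -
    have "dist z y < dist z y'" if "z \<in> M y" for z
      using that \<open>y' \<in> P\<close> \<open>y \<noteq> y'\<close> unfolding M_def by blast
    moreover have "dist z y' < dist z y" if "z \<in> M y'" for z
      using that \<open>y \<in> P\<close> \<open>y \<noteq> y'\<close> unfolding M_def by blast
    ultimately show ?thesis by (meson disjoint_iff order_less_asym)
  qed
  \<comment> \<open>Removing the image of the rest of \<open>K\<close> leaves no preimage of
    \<open>T\<close> outside the sets \<open>M y\<close>, so the sheets exhaust the
    preimage.\<close>
  define T where "T = D \<inter> (\<Inter>y\<in>P. f ` M y) - f ` (K - (\<Union>y\<in>P. M y))"
  have oT: "open T"
  proof -
    have "open (\<Inter>y\<in>P. f ` M y)" using finP M opn by (intro open_INT) auto
    moreover have "closed (f ` (K - (\<Union>y\<in>P. M y)))"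
      using M(1) by (intro clf closed_Diff compact_imp_closed[OF K(1)] open_UN) auto
    ultimately show ?thesis unfolding T_def using D(1) by (intro open_Diff open_Int)
  qed
  have pT: "p \<in> T"
  proof -
    have "p \<in> f ` M y" if "y \<in> P" for y using M(2)[OF that] that unfolding P_def by force
    moreover have "p \<notin> f ` (K - (\<Union>y\<in>P. M y))" using M(2) unfolding P_def by fastforce
    ultimately show ?thesis using p unfolding T_def by blast
  qed
  have TD: "T \<subseteq> D" unfolding T_def by blast
  define v where "v = (\<lambda>y. M y \<inter> f -` T) ` P"
  have "\<Union>v = U \<inter> f -` T"
  proof
    show "\<Union>v \<subseteq> U \<inter> f -` T" unfolding v_def using M(3) by blast
    show "U \<inter> f -` T \<subseteq> \<Union>v" unfolding v_def T_def using U_sub by auto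
  qed
  moreover have ov: "open u" if u: "u \<in> v" for u
  proof -
    obtain y where y: "y \<in> P" "u = M y \<inter> f -` T" using u unfolding v_def by blast
    have "continuous_on (M y) f" using cU M(3)[OF y(1)] continuous_on_subset by blast
    then show ?thesis using continuous_open_preimage[of "M y" f T] M(1)[OF y(1)] oT y(2) by blast
  qed
  moreover have "openin (top_of_set U) u" if u: "u \<in> v" for u
    using ov[OF u] u M(3) oU unfolding v_def openin_open_eq[OF oU] by blast
  moreover have "pairwise disjnt v"
    unfolding v_def pairwise_def disjnt_def using M_disj by blast
  moreover have "\<exists>q. homeomorphism u T f q" if u: "u \<in> v" for u
  proof -
    obtain y where y: "y \<in> P" "u = M y \<inter> f -` T" using u unfolding v_def by blast
    have "T \<subseteq> f ` M y" using y(1) unfolding T_def by blast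
    then have "f ` u = T" using y(2) by blast
    moreover have "inj_on f u" "u \<subseteq> U" using y M(3,4)[OF y(1)] by (auto intro: inj_on_subset)
    moreover have "continuous_on u f" using cU \<open>u \<subseteq> U\<close> continuous_on_subset by blast
    ultimately show ?thesis
      using invariance_of_domain_homeomorphism[OF ov[OF u], of f] by (metis order_refl)
  qed
  ultimately show "\<exists>T. p \<in> T \<and> openin (top_of_set D) T \<and>
      (\<exists>v. \<Union>v = K \<inter> f -` D \<inter> f -` T \<and> (\<forall>u\<in>v. openin (top_of_set (K \<inter> f -` D)) u) \<and>
        pairwise disjnt v \<and> (\<forall>u\<in>v. \<exists>q. homeomorphism u T f q))"
    using pT oT TD D(1) unfolding U_def[symmetric]
    by (intro exI[of _ T] conjI exI[of _ v]) (auto simp: openin_open_eq)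
qed

text \<open>Lifting the identity of \<open>D\<close> gives a section \<open>g\<close> with
  \<open>g (f y) = y\<close>. On \<open>C\<close> both \<open>g o f\<close> and the identity lift
  \<open>f\<close> and agree at \<open>y\<close>, so connectedness makes them equal; then
  \<open>f y = f z\<close> forces \<open>z = g (f z) = y\<close>.\<close>

lemma covering_space_inj_on_connected:
  fixes f :: "'a::real_normed_vector \<Rightarrow> 'b::real_normed_vector"
  assumes cov: "covering_space U f D" and D: "simply_connected D" "locally path_connected D"
    and C: "connected C" "C \<subseteq> U"
  shows "inj_on f C"
proof
  fix y z assume yz: "y \<in> C" "z \<in> C" "f y = f z"
  have fU: "f ` U = D" and cf: "continuous_on U f"
    using cov by (simp_all add: covering_space_imp_surjective covering_space_imp_continuous)
  have cC: "continuous_on C f" using cf C(2) continuous_on_subset by blast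
  have fC: "f ` C \<subseteq> D" using fU C(2) by blast
  obtain g where g: "continuous_on D g" "g \<in> D \<rightarrow> U" "g (f y) = y" "\<And>w. w \<in> D \<Longrightarrow> f (g w) = w"
    using covering_space_lift_strong[OF cov, of y "f y" D id] yz C(2) fU D
    by (auto simp: subset_iff)
  have "g (f z) = z"
  proof (rule covering_space_lift_unique[OF cov, of "\<lambda>w. g (f w)" y "\<lambda>w. w" C f])
    show "continuous_on C (\<lambda>x. g (f x))"
      using continuous_on_compose2[OF g(1) cC fC] .
  qed (use g C yz fC cC in \<open>auto\<close>)
  then show "y = z" using g yz by simp
qed

subsection \<open>Everywhere differentiable maps with injective derivatives\<close>

text \<open>Sussmann's open mapping theorem asks for continuity and a right inverse of the
  derivative at one point, not for a continuous derivative. In finite dimension an injective linear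
  endomorphism has a right inverse.\<close>

lemma everywhere_nonsingular_open_map:
  fixes f :: "'a::euclidean_space \<Rightarrow> 'a"
  assumes "open S" "\<And>x. x \<in> S \<Longrightarrow> (f has_derivative f' x) (at x)" "\<And>x. x \<in> S \<Longrightarrow> inj (f' x)"
    and "open T" "T \<subseteq> S"
  shows "open (f ` T)"
proof -
  have cf: "continuous_on S f"
    using assms(2) by (meson continuous_at_imp_continuous_on has_derivative_continuous)
  have "f x \<in> interior (f ` T)" if x: "x \<in> T" for x
  proof -
    have l: "linear (f' x)" using assms x by (meson has_derivative_linear subsetD)
    obtain g where g: "linear g" "f' x \<circ> g = id"
      using linear_injective_isomorphism[OF l] assms x by (metis comp_apply eq_id_iff subsetD ext)
    show ?thesis
    proof (rule sussmann_open_mapping[OF assms(1) cf _ _ _ g(2) assms(5)])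
      show "bounded_linear g" using g(1) by (simp add: linear_conv_bounded_linear)
      show "x \<in> interior T" using x assms(4) by (simp add: interior_open)
    qed (use x assms in auto)
  qed
  then show ?thesis by (metis image_subsetI interior_eq interior_subset subset_antisym)
qed

text \<open>Take a frontier point \<open>z\<close> of \<open>A\<close> in \<open>B\<close> and a
  point \<open>a\<close> of \<open>A\<close> close to it. The point \<open>b\<close> outside
  \<open>A\<close> nearest to \<open>a\<close> is at most twice as far from \<open>z\<close> as
  \<open>a\<close> is, hence still in \<open>B\<close>.\<close>

lemma open_touching_ball:
  fixes A :: "'a::euclidean_space set"
  assumes "open A" "A \<subset> B" "A \<noteq> {}" "open B" "connected B"
  obtains a b where "a \<in> A" "b \<in> B - A" "ball a (dist a b) \<subseteq> A"
proof -
  have "B \<inter> frontier A \<noteq> {}"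
    using connected_Int_frontier[OF assms(5), of A] assms(2,3) by blast
  then obtain z where z: "z \<in> B" "z \<in> closure A" "z \<notin> A"
    using assms(1) by (auto simp: frontier_def interior_open)
  obtain \<delta> where \<delta>: "\<delta> > 0" "ball z \<delta> \<subseteq> B" using assms(4) z(1) open_contains_ball by blast
  obtain a where a: "a \<in> A" "dist a z < \<delta> / 2" using z(2) \<delta>(1) closure_approachable by (metis half_gt_zero)
  obtain b where b: "b \<in> - A" "\<And>y. y \<in> - A \<Longrightarrow> dist a b \<le> dist a y"
    using distance_attains_inf[of "- A" a] assms(1) z(3) by (metis ComplI closed_Compl empty_iff)
  have "dist z b < \<delta>"
    using dist_triangle[of z b a] b(2)[of z] z(3) a(2) by (simp add: dist_commute)
  then have "b \<in> B - A" using \<delta>(2) b(1) by auto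
  moreover have "ball a (dist a b) \<subseteq> A" using b(2) by force
  ultimately show ?thesis using that a(1) by blast
qed

lemma has_derivative_inj_lower_bound:
  fixes f :: "'a::euclidean_space \<Rightarrow> 'b::euclidean_space"
  assumes "(f has_derivative f') (at x)" "inj f'"
  obtains c d where "c > 0" "d > 0" "\<And>y. dist y x < d \<Longrightarrow> c * dist y x \<le> dist (f y) (f x)"
proof -
  obtain \<beta> where \<beta>: "\<beta> > 0" "\<And>h. \<beta> * norm h \<le> norm (f' h)"
    using linear_inj_bounded_below_pos[OF has_derivative_linear[OF assms(1)] assms(2)] by blast
  obtain d where d: "d > 0" "\<And>y. norm (y - x) < d \<Longrightarrow> norm (f y - f x - f' (y - x)) \<le> \<beta>/2 * norm (y - x)"
    using assms(1) \<beta>(1) unfolding has_derivative_at_alt by (metis half_gt_zero)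
  have "\<beta>/2 * dist y x \<le> dist (f y) (f x)" if "dist y x < d" for y
  proof -
    have "norm (f' (y - x)) \<le> norm (f y - f x) + norm (f y - f x - f' (y - x))"
      by (metis norm_minus_commute norm_triangle_sub)
    then show ?thesis using d(2)[of y] \<beta>(2)[of "y - x"] that by (simp add: dist_norm)
  qed
  then show ?thesis using that[of "\<beta>/2" d] \<beta>(1) d(1) by simp
qed

text \<open>Differentiability gives every point its own constant and radius for the lower bound;
  Baire's theorem makes both uniform near some point of \<open>E\<close>.\<close>

lemma baire_lower_bound:
  fixes f :: "'a::euclidean_space \<Rightarrow> 'b::euclidean_space"
  assumes S: "open S" and f': "\<And>x. x \<in> S \<Longrightarrow> (f has_derivative f' x) (at x)" "\<And>x. x \<in> S \<Longrightarrow> inj (f' x)"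
    and x: "x \<in> E" "E \<subseteq> S"
  obtains y r c where "y \<in> E" "r > 0" "c > 0" "ball y r \<subseteq> S"
    "\<And>a b. a \<in> E \<inter> ball y r \<Longrightarrow> b \<in> ball y r \<Longrightarrow> c * dist b a \<le> dist (f b) (f a)"
proof -
  obtain \<rho> where \<rho>: "\<rho> > 0" "cball x \<rho> \<subseteq> S" using S x by (meson open_contains_cball subsetD)
  \<comment> \<open>Baire's theorem wants a closed set; the points of this closure stay in a closed
    ball inside \<open>S\<close>, where \<open>f\<close> is differentiable.\<close>
  define Z where "Z = closure (E \<inter> ball x \<rho>)"
  have ZB: "Z \<subseteq> cball x \<rho>" unfolding Z_def by (meson closure_minimal closed_cball ball_subset_cball inf.coboundedI2)
  have xZ: "x \<in> Z" unfolding Z_def using x \<rho>(1) closure_subset by fastforce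
  have cf: "continuous_on (cball x \<rho>) f"
    using f'(1) \<rho>(2) by (meson continuous_at_imp_continuous_on has_derivative_continuous subsetD)
  \<comment> \<open>One index serves for both constant and radius. These sets are closed by
    continuity of \<open>f\<close> and cover \<open>Z\<close> by the pointwise bounds.\<close>
  define Y where "Y n = {a \<in> Z. \<forall>b \<in> cball x \<rho>. dist b a < 1 / Suc n \<longrightarrow> dist b a / Suc n \<le> dist (f b) (f a)}" for n :: nat
  have clY: "closed (Y n)" for n
    unfolding closed_sequential_limits
  proof (intro allI impI; elim conjE)
    fix u l assume u: "\<forall>k. u k \<in> Y n" "u \<longlonglongrightarrow> l"
    have uZ: "\<And>k. u k \<in> Z" using u(1) unfolding Y_def by blast
    have lZ: "l \<in> Z" using closed_sequentially[of Z u l] uZ u(2) by (simp add: Z_def)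
    have fu: "(\<lambda>k. f (u k)) \<longlonglongrightarrow> f l"
      using continuous_on_tendsto_compose[OF cf u(2)] lZ ZB uZ by (meson always_eventually subsetD)
    have "dist b l / Suc n \<le> dist (f b) (f l)" if b: "b \<in> cball x \<rho>" "dist b l < 1 / Suc n" for b
    proof -
      have "(\<lambda>k. dist b (u k)) \<longlonglongrightarrow> dist b l" by (intro tendsto_intros u)
      then have "eventually (\<lambda>k. dist b (u k) < 1 / Suc n) sequentially"
        using b(2) order_tendstoD(2) by blast
      then have "eventually (\<lambda>k. dist b (u k) / Suc n \<le> dist (f b) (f (u k))) sequentially"
        by eventually_elim (use u(1) b(1) in \<open>auto simp: Y_def\<close>)
      moreover have "(\<lambda>k. dist b (u k) / Suc n) \<longlonglongrightarrow> dist b l / Suc n"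
        by (intro tendsto_intros u) auto
      moreover have "(\<lambda>k. dist (f b) (f (u k))) \<longlonglongrightarrow> dist (f b) (f l)"
        by (intro tendsto_intros fu)
      ultimately show ?thesis using tendsto_le[OF sequentially_bot] by blast
    qed
    then show "l \<in> Y n" unfolding Y_def using lZ by blast
  qed
  have cover: "\<exists>n. a \<in> Y n" if a: "a \<in> Z" for a
  proof -
    have aS: "a \<in> S" using a ZB \<rho>(2) by blast
    obtain c d where cd: "c > 0" "d > 0" "\<And>b. dist b a < d \<Longrightarrow> c * dist b a \<le> dist (f b) (f a)"
      using has_derivative_inj_lower_bound[OF f'[OF aS]] by blast
    obtain n where n: "inverse (real (Suc n)) < min c d" using reals_Archimedean[of "min c d"] cd by auto
    have "dist b a / Suc n \<le> dist (f b) (f a)" if "dist b a < 1 / Suc n" for b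
    proof -
      have "dist b a / Suc n \<le> c * dist b a"
        using n mult_right_mono[of "inverse (real (Suc n))" c "dist b a"] by (simp add: divide_inverse mult.commute)
      also have "\<dots> \<le> dist (f b) (f a)" using n that by (intro cd) (simp add: divide_inverse)
      finally show ?thesis .
    qed
    then show ?thesis unfolding Y_def using a by blast
  qed
  \<comment> \<open>Otherwise the relatively open sets \<open>Z - Y n\<close> would all be dense in
    \<open>Z\<close>, and so would their empty intersection.\<close>
  have "\<exists>n. \<not> Z \<subseteq> closure (Z - Y n)"
  proof (rule ccontr)
    assume "\<not> ?thesis"
    then have d: "\<And>n. Z \<subseteq> closure (Z - Y n)" by blast
    have "Z \<subseteq> closure (\<Inter> (range (\<lambda>n. Z - Y n)))"
    proof (rule Baire)
      show "closed Z" by (simp add: Z_def)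
      fix T assume "T \<in> range (\<lambda>n. Z - Y n)"
      then show "openin (top_of_set Z) T \<and> Z \<subseteq> closure T"
        using d clY by (metis (no_types, lifting) imageE openin_open_Int Diff_eq open_Compl)
    qed auto
    moreover have "\<Inter> (range (\<lambda>n. Z - Y n)) = {}" using cover by auto
    ultimately show False using xZ by (metis closure_empty empty_iff subsetD)
  qed
  then obtain n z where n: "z \<in> Z" "z \<notin> closure (Z - Y n)" by blast
  then obtain e where e: "e > 0" "ball z e \<inter> (Z - Y n) = {}"
    unfolding closure_approachable by (fastforce simp: dist_commute)
  obtain y where y: "y \<in> E \<inter> ball x \<rho>" "dist y z < e"
    using n(1) e(1) unfolding Z_def closure_approachable by blast
  have "open (ball z e \<inter> ball x \<rho>)" "y \<in> ball z e \<inter> ball x \<rho>" using y by (auto simp: dist_commute)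
  then obtain r0 where r0: "r0 > 0" "ball y r0 \<subseteq> ball z e \<inter> ball x \<rho>" using open_contains_ball by blast
  \<comment> \<open>Two points of a ball of this radius are less than \<open>1 / Suc n\<close>
    apart, as the condition in \<open>Y n\<close> demands.\<close>
  define r where "r = min r0 (1 / Suc n / 2)"
  have r: "r > 0" "ball y r \<subseteq> ball y r0" using r0 unfolding r_def by auto
  have r2: "2 * r \<le> 1 / Suc n" unfolding r_def by (simp add: min_def field_simps)
  show ?thesis
  proof (rule that[of y r "1 / Suc n"])
    show "ball y r \<subseteq> S" using r r0 \<rho> by (meson ball_subset_cball inf.boundedE order_trans)
    fix a b assume a: "a \<in> E \<inter> ball y r" and b: "b \<in> ball y r"
    have "a \<in> E \<inter> ball x \<rho>" "a \<in> ball z e" using a r r0 by blast+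
    then have "a \<in> Y n" using e(2) closure_subset unfolding Z_def by blast
    moreover have "dist b a < 1 / Suc n"
      using a b r2 dist_triangle2[of b a y] by (auto simp: dist_commute)
    moreover have "b \<in> cball x \<rho>" using b r r0 ball_subset_cball by blast
    ultimately show "1 / Suc n * dist b a \<le> dist (f b) (f a)" unfolding Y_def by auto
  qed (use y r in auto)
qed


section \<open>Local injectivity by way of the set of double values\<close>

theorem everywhere_nonsingular_locally_injective:
  fixes f :: "'a::euclidean_space \<Rightarrow> 'a"
  assumes S: "open S" and f': "\<And>x. x \<in> S \<Longrightarrow> (f has_derivative f' x) (at x)" "\<And>x. x \<in> S \<Longrightarrow> inj (f' x)"
    and "x \<in> S"
  shows "\<exists>N. open N \<and> x \<in> N \<and> N \<subseteq> S \<and> inj_on f N"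
proof (rule ccontr)
  define E where "E = {x \<in> S. \<not> (\<exists>N. open N \<and> x \<in> N \<and> N \<subseteq> S \<and> inj_on f N)}"
  assume "\<not> ?thesis"
  then have "x \<in> E" unfolding E_def using \<open>x \<in> S\<close> by blast
  then obtain x0 r c where x0: "x0 \<in> E" and rc: "r > 0" "c > 0" and rS: "ball x0 r \<subseteq> S"
    and low: "\<And>a b. a \<in> E \<inter> ball x0 r \<Longrightarrow> b \<in> ball x0 r \<Longrightarrow> c * dist b a \<le> dist (f b) (f a)"
    using baire_lower_bound[OF S f', of x E] unfolding E_def by blast
  define K where "K = cball x0 (r/2)"
  \<comment> \<open>With this radius, \<open>low\<close> at \<open>x0\<close> keeps points of
    \<open>K\<close> with value in \<open>B\<close> off the bounding sphere. Hence preimages in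
    \<open>K\<close> of open subsets of \<open>B\<close> are open, as the covering lemma
    requires.\<close>
  define B where "B = ball (f x0) (c * (r/2))"
  define U where "U = K \<inter> f -` B"
  have K: "compact K" "K \<subseteq> ball x0 r" "K \<subseteq> S" using rc rS by (auto simp: K_def)
  have cf: "continuous_on S f"
    using f'(1) by (meson continuous_at_imp_continuous_on has_derivative_continuous)
  have cK: "continuous_on K f" using cf K(3) continuous_on_subset by blast
  have B: "open B" "connected B" by (auto simp: B_def)
  have U_eq: "U = ball x0 (r/2) \<inter> f -` B"
  proof -
    have "dist y x0 < r/2" if "y \<in> U" for y
    proof -
      have "c * dist y x0 \<le> dist (f y) (f x0)"
        using low[of x0 y] x0 rc that K unfolding U_def by auto
      also have "\<dots> < c * (r/2)" using that unfolding U_def B_def by (simp add: dist_commute)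
      finally show ?thesis using rc by (simp add: mult_less_cancel_left)
    qed
    then show ?thesis unfolding U_def K_def by (auto simp: dist_commute)
  qed
  have UV: "open (K \<inter> f -` V)" if V: "open V" "V \<subseteq> B" for V
  proof -
    have "K \<inter> f -` V = ball x0 (r/2) \<inter> f -` V" using V(2) U_eq unfolding U_def by blast
    moreover have "continuous_on (ball x0 (r/2)) f" using cK unfolding K_def
      by (meson ball_subset_cball continuous_on_subset)
    ultimately show ?thesis using V(1) by (simp add: continuous_open_preimage)
  qed
  have oU: "open U" unfolding U_def using UV B by blast
  have US: "U \<subseteq> K" "U \<subseteq> S" "U \<subseteq> ball x0 r" using K unfolding U_def by auto
  have x0U: "x0 \<in> U" using rc unfolding U_def K_def B_def by simp
  have om: "open (f ` T)" if "open T" "T \<subseteq> S" for T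
    using everywhere_nonsingular_open_map[OF S f' that] by blast
  define A where "A = {p. \<exists>a b. a \<in> U \<and> b \<in> U \<and> a \<noteq> b \<and> f a = p \<and> f b = p}"
  have AB: "A \<subseteq> B" unfolding A_def U_def by blast
  have single: "y = e" if "e \<in> E \<inter> U" "y \<in> U" "f y = f e" for e y
  proof -
    have "e \<in> E \<inter> ball x0 r" "y \<in> ball x0 r" using that US(3) by blast+
    then have "c * dist y e \<le> 0" using low[of e y] that(3) by simp
    then show ?thesis using rc by (simp add: mult_le_0_iff)
  qed
  have notA: "f e \<notin> A" if "e \<in> E \<inter> U" for e
  proof
    assume "f e \<in> A"
    then obtain a b where ab: "a \<in> U" "b \<in> U" "a \<noteq> b" "f a = f e" "f b = f e" unfolding A_def by blast
    show False using single[OF that ab(1,4)] single[OF that ab(2,5)] ab(3) by simp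
  qed
  \<comment> \<open>Disjoint neighbourhoods of two preimages have open images, and any common value
    of these is again taken twice.\<close>
  have oA: "open A"
    unfolding open_subopen[of A]
  proof
    fix p assume "p \<in> A"
    then obtain a b where ab: "a \<in> U" "b \<in> U" "a \<noteq> b" "f a = p" "f b = p" unfolding A_def by blast
    obtain M N where MN: "open M" "open N" "a \<in> M" "b \<in> N" "M \<inter> N = {}" using hausdorff[OF ab(3)] by blast
    have "open (f ` (M \<inter> U) \<inter> f ` (N \<inter> U))" using MN oU US om by (intro open_Int om) auto
    moreover have "p \<in> f ` (M \<inter> U) \<inter> f ` (N \<inter> U)"
      by (rule IntI; rule image_eqI) (use ab MN(3,4) in auto)
    moreover have "f ` (M \<inter> U) \<inter> f ` (N \<inter> U) \<subseteq> A"
    proof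
      fix q assume "q \<in> f ` (M \<inter> U) \<inter> f ` (N \<inter> U)"
      then obtain u w where uw: "u \<in> M" "u \<in> U" "f u = q" "w \<in> N" "w \<in> U" "f w = q" by auto
      moreover have "u \<noteq> w" using MN(5) uw by auto
      ultimately show "q \<in> A" unfolding A_def by auto
    qed
    ultimately show "\<exists>T. open T \<and> p \<in> T \<and> T \<subseteq> A" by blast
  qed
  \<comment> \<open>Otherwise the at most one preimage of \<open>q\<close> has an injective
    neighbourhood \<open>N\<close>. By compactness of \<open>K - N\<close>, double values near
    \<open>q\<close> have both preimages in \<open>N\<close>, which is absurd.\<close>
  have frontier: "q \<in> f ` (E \<inter> U)" if q: "q \<in> B - A" "q \<in> closure A" for q
  proof (rule ccontr)
    assume nE: "q \<notin> f ` (E \<inter> U)"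
    obtain N where N: "open N" "inj_on f N" "\<And>y. y \<in> K \<Longrightarrow> f y = q \<Longrightarrow> y \<in> N"
    proof (cases "\<exists>y\<in>K. f y = q")
      case True
      then obtain y where y: "y \<in> U" "f y = q" using q(1) unfolding U_def by blast
      then have "y \<notin> E" using nE by blast
      then obtain N where "open N" "y \<in> N" "inj_on f N" using y(1) US unfolding E_def by blast
      moreover have "z = y" if "z \<in> K" "f z = q" for z
        using that y q(1) unfolding A_def U_def by auto
      ultimately show ?thesis using that by blast
    next
      case False
      then show ?thesis using that[of "{}"] by auto
    qed
    have "compact (f ` (K - N))" using K(1) N(1) cK
      by (meson Diff_subset compact_continuous_image compact_diff continuous_on_subset)
    then have "open (- f ` (K - N))" using compact_imp_closed by blast
    moreover have "q \<in> - f ` (K - N)" using N(3) by blast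
    ultimately have "- f ` (K - N) \<inter> A \<noteq> {}" using q(2) by (metis IntI empty_iff open_Int_closure_eq_empty)
    then obtain a b where ab: "a \<in> U" "b \<in> U" "a \<noteq> b" "f a = f b" "f a \<notin> f ` (K - N)"
      unfolding A_def by auto
    then have "a \<in> N" "b \<in> N" using US(1) by (metis DiffI imageI subsetD)+
    then show False using N(2) ab(3,4) by (simp add: inj_on_def)
  qed
  have "inj_on f U"
  proof (rule ccontr)
    assume "\<not> inj_on f U"
    then have "A \<noteq> {}" unfolding A_def inj_on_def by blast
    moreover have "A \<noteq> B" using notA[of x0] x0 x0U unfolding U_def by blast
    ultimately obtain a b where ab: "a \<in> A" "b \<in> B - A" "ball a (dist a b) \<subseteq> A"
      using open_touching_ball[OF oA _ _ B] AB by blast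
    have nab: "a \<noteq> b" using ab by blast
    have "b \<in> closure (ball a (dist a b))" using nab by (simp add: dist_commute)
    then have "b \<in> closure A" using ab(3) closure_mono by blast
    then obtain e where e: "e \<in> E" "e \<in> U" "f e = b" using frontier ab(2) by blast
    define L where "L = f' e"
    have eS: "e \<in> S" using e US by blast
    have lin: "linear L" unfolding L_def using f'(1)[OF eS] has_derivative_linear by blast
    obtain \<beta> where \<beta>: "\<beta> > 0" "\<And>h. \<beta> * norm h \<le> norm (L h)"
      using linear_inj_bounded_below_pos[OF lin] f'(2)[OF eS] unfolding L_def by blast
    \<comment> \<open>With a third of both constants, the remainder of the linear approximation will
      stay below half the radius of \<open>D\<close>, whether \<open>w\<close> is controlled through
      \<open>\<beta>\<close> (in \<open>CK\<close>) or through \<open>c\<close> (in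
      \<open>inC\<close>).\<close>
    define \<epsilon> where "\<epsilon> = min \<beta> c / 3"
    have \<epsilon>: "\<epsilon> > 0" "3 * \<epsilon> \<le> \<beta>" "3 * \<epsilon> \<le> c" using \<beta>(1) rc by (auto simp: \<epsilon>_def)
    obtain d0 where d0: "d0 > 0" "\<And>y. norm (y - e) < d0 \<Longrightarrow> norm (f y - f e - L (y - e)) \<le> \<epsilon> * norm (y - e)"
      using f'(1)[OF eS] \<epsilon>(1) unfolding has_derivative_at_alt L_def by blast
    obtain d1 where d1: "d1 > 0" "ball e d1 \<subseteq> U" using oU e(2) open_contains_ball by blast
    define d where "d = min d0 d1"
    have d: "d > 0" "\<And>y. norm (y - e) < d \<Longrightarrow> norm (f y - b - L (y - e)) \<le> \<epsilon> * norm (y - e)"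
      "\<And>y. norm (y - e) < d \<Longrightarrow> y \<in> U"
      using d0 d1 e(3) by (auto simp: d_def dist_norm norm_minus_commute)
    define s where "s = dist a b"
    have s: "s > 0" using nab by (simp add: s_def)
    \<comment> \<open>All points considered below turn out to lie within \<open>t * m\<close> of
      \<open>e\<close>; \<open>t\<close> is then chosen so that this is less than \<open>d\<close>,
      where the linear approximation is valid.\<close>
    define m where "m = s / (2 * \<epsilon>)"
    have m: "m > 0" using s \<epsilon>(1) by (simp add: m_def)
    define t where "t = min 1 (d / (2 * m))"
    have t: "0 < t" "t \<le> 1" using d(1) m by (auto simp: t_def)
    have tm: "t * m < d"
    proof -
      have "t * m \<le> d / (2 * m) * m" using m by (intro mult_right_mono) (auto simp: t_def)
      then show ?thesis using m d(1) by simp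
    qed
    \<comment> \<open>\<open>D\<close> is the touching ball shrunk by the factor \<open>t\<close>
      towards the point of contact \<open>b\<close>, so it still lies in \<open>A\<close>.\<close>
    define p where "p = b + t *\<^sub>R (a - b)"
    define D where "D = ball p (t * s)"
    have ts: "t * s > 0" using t s by simp
    have nts: "norm (t *\<^sub>R (a - b)) = t * s" using t by (simp add: s_def dist_norm)
    have DA: "D \<subseteq> A"
    proof -
      have "dist p a = (1 - t) * s"
      proof -
        have "p - a = (1 - t) *\<^sub>R (b - a)" unfolding p_def by (simp add: algebra_simps)
        then show ?thesis using t by (simp add: s_def dist_norm norm_minus_commute)
      qed
      then have "D \<subseteq> ball a s" unfolding D_def
        by (intro ball_subset_ball_iff[THEN iffD2]) (simp add: algebra_simps)
      then show ?thesis using ab(3) unfolding s_def by blast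
    qed
    have pA: "p \<in> A" using DA ts unfolding D_def by auto
    obtain y z where yz: "y \<in> U" "z \<in> U" "y \<noteq> z" "f y = p" "f z = p" using pA unfolding A_def by blast
    have DB: "D \<subseteq> B" using DA AB by blast
    have pb: "dist p b = t * s" using nts unfolding p_def by (simp add: dist_norm)
    \<comment> \<open>\<open>C\<close> is the preimage of half the ball \<open>D\<close> under the linearization of \<open>f\<close> at \<open>e\<close>\<close>
    define C where "C = (\<lambda>h. L (h - e)) -` ball (t *\<^sub>R (a - b)) (t * s / 2)"
    have "convex C"
    proof -
      have "C = (\<lambda>h. e + h) ` (L -` ball (t *\<^sub>R (a - b)) (t * s / 2))"
        unfolding C_def by (auto intro!: image_eqI[where x = "_ - e"])
      then show ?thesis using lin convex_linear_vimage[OF lin convex_ball] convex_translation by metis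
    qed
    \<comment> \<open>Half of the radius of \<open>D\<close> is spent on the linearized position,
      the other half on the remainder.\<close>
    have CK: "C \<subseteq> K \<inter> f -` D"
    proof
      fix w assume "w \<in> C"
      then have w: "norm (L (w - e) - t *\<^sub>R (a - b)) < t * s / 2"
        unfolding C_def by (simp add: dist_norm norm_minus_commute)
      have "norm (L (w - e)) < 3/2 * (t * s)"
        using w nts norm_triangle_sub[of "L (w - e)" "t *\<^sub>R (a - b)"] by linarith
      then have "3 * (\<epsilon> * norm (w - e)) < 3/2 * (t * s)"
        using \<beta>(2)[of "w - e"] mult_right_mono[OF \<epsilon>(2) norm_ge_zero, of "w - e"]
        unfolding mult.assoc[symmetric] by linarith
      then have k: "\<epsilon> * norm (w - e) < t * s / 2" by linarith
      then have "norm (w - e) < t * m" using \<epsilon>(1) s t ts unfolding m_def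
        by (simp add: field_simps)
      then have wd: "norm (w - e) < d" using tm by simp
      have "norm (f w - p) \<le> norm (f w - b - L (w - e)) + norm (L (w - e) - t *\<^sub>R (a - b))"
        using norm_triangle_ineq[of "f w - b - L (w - e)" "L (w - e) - t *\<^sub>R (a - b)"]
        unfolding p_def by (simp add: algebra_simps)
      also have "\<dots> < t * s" using d(2)[OF wd] k w by linarith
      finally show "w \<in> K \<inter> f -` D"
        using d(3)[OF wd] US unfolding D_def by (auto simp: dist_norm norm_minus_commute)
    qed
    \<comment> \<open>The uniform bound \<open>low\<close> at \<open>e\<close> first brings every
      preimage of \<open>p\<close> close to \<open>e\<close>; only then does the linear
      approximation apply to it.\<close>
    have inC: "w \<in> C" if w: "w \<in> U" "f w = p" for w
    proof -
      have "e \<in> E \<inter> ball x0 r" "w \<in> ball x0 r" using e w US(3) by blast+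
      then have "c * dist w e \<le> t * s" using low[of e w] e(3) w(2) pb by simp
      then have "3 * (\<epsilon> * norm (w - e)) \<le> t * s"
        using mult_right_mono[OF \<epsilon>(3), of "norm (w - e)"] by (simp add: dist_norm mult.assoc)
      then have k: "\<epsilon> * norm (w - e) < t * s / 2" using ts by linarith
      then have "norm (w - e) < t * m" using \<epsilon>(1) s t ts unfolding m_def
        by (simp add: field_simps)
      then have wd: "norm (w - e) < d" using tm by simp
      have "norm (t *\<^sub>R (a - b) - L (w - e)) < t * s / 2"
        using d(2)[OF wd] k w(2) unfolding p_def by simp
      then show ?thesis unfolding C_def by (simp add: dist_norm)
    qed
    \<comment> \<open>No point over \<open>D\<close> lies in \<open>E\<close>, since
      \<open>D\<close> consists of double values and values at \<open>E\<close> are taken once. So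
      \<open>f\<close> is locally injective there.\<close>
    have "covering_space (K \<inter> f -` D) f D"
    proof (rule proper_local_injection_covering[OF K(1) cK])
      show "open (K \<inter> f -` D)" using UV[OF _ DB] by (simp add: D_def)
      show "K \<inter> f -` D \<noteq> {}" using CK inC yz by blast
      fix w assume w: "w \<in> K \<inter> f -` D"
      then have "w \<in> U" "w \<notin> E" using DB DA notA unfolding U_def by blast+
      then show "\<exists>N. open N \<and> w \<in> N \<and> inj_on f N" using US unfolding E_def by blast
    qed (auto simp: D_def)
    then have "inj_on f C"
      using CK \<open>convex C\<close> convex_connected convex_imp_simply_connected
      by (intro covering_space_inj_on_connected[where U = "K \<inter> f -` D" and D = D])
        (auto simp: D_def convex_imp_locally_path_connected)
    then show False using inC yz unfolding inj_on_def by metis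
  qed
  then show False using x0 x0U oU US unfolding E_def by blast
qed

subsection \<open>Implicit functions\<close>

text \<open>The injective neighbourhoods may depend on \<open>p\<close> with no uniform size. For
  \<open>p\<close> near \<open>p0\<close> the covering argument is repeated: surjectivity gives a
  solution in \<open>K\<close>, and injectivity on a ball \<open>C\<close> containing all solutions
  gives uniqueness. Continuity follows from a closed graph in a compact set.\<close>

lemma implicit_function_locally_injective:
  fixes f :: "'p::euclidean_space \<Rightarrow> 'a::euclidean_space \<Rightarrow> 'a"
  assumes S: "open S" "p0 \<in> S" and W: "open W" "y0 \<in> W"
    and cont: "continuous_on (S \<times> W) (\<lambda>(p, y). f p y)"
    and inj: "\<And>p y. p \<in> S \<Longrightarrow> y \<in> W \<Longrightarrow> \<exists>N. open N \<and> y \<in> N \<and> inj_on (f p) N"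
  obtains \<delta> \<phi> where "\<delta> > 0" "cball p0 \<delta> \<subseteq> S" "continuous_on (cball p0 \<delta>) \<phi>" "\<phi> p0 = y0"
    "\<And>p. p \<in> cball p0 \<delta> \<Longrightarrow> \<phi> p \<in> W \<and> f p (\<phi> p) = f p0 y0"
proof -
  obtain N where N: "open N" "y0 \<in> N" "inj_on (f p0) N" using inj S(2) W(2) by blast
  have "open (N \<inter> W)" "y0 \<in> N \<inter> W" using N W by auto
  then obtain r where r: "r > 0" "cball y0 r \<subseteq> N \<inter> W" using open_contains_cball by blast
  define K where "K = cball y0 r"
  have K: "compact K" "K \<subseteq> W" "K \<subseteq> N" "y0 \<in> K" using r by (auto simp: K_def)
  define q0 where "q0 = f p0 y0"
  have single: "y = y0" if "y \<in> K" "f p0 y = q0" for y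
    using N(3) K that unfolding inj_on_def q0_def by blast
  have cp: "continuous_on K (f p)" if "p \<in> S" for p
  proof -
    have "continuous_on K (\<lambda>y. case (p, y) of (p, y) \<Rightarrow> f p y)"
      by (rule continuous_on_compose2[OF cont]) (use that K in \<open>auto intro!: continuous_intros\<close>)
    then show ?thesis by simp
  qed
  obtain \<rho> where \<rho>: "\<rho> > 0" "cball p0 \<rho> \<subseteq> S" using S open_contains_cball by blast
  have near: "\<exists>\<delta>>0. \<delta> \<le> \<rho> \<and> (\<forall>p\<in>cball p0 \<delta>. \<forall>y\<in>K. dist (f p y) (f p0 y) < e)" if e: "e > 0" for e
  proof -
    have "uniformly_continuous_on (cball p0 \<rho> \<times> K) (\<lambda>(p, y). f p y)"
      using \<rho>(2) K by (intro compact_uniformly_continuous continuous_on_subset[OF cont] compact_Times) auto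
    then obtain d where d: "d > 0"
      "\<And>u v. u \<in> cball p0 \<rho> \<times> K \<Longrightarrow> v \<in> cball p0 \<rho> \<times> K \<Longrightarrow> dist v u < d \<Longrightarrow>
        dist (case v of (p, y) \<Rightarrow> f p y) (case u of (p, y) \<Rightarrow> f p y) < e"
      using e unfolding uniformly_continuous_on_def by metis
    have "dist (f p y) (f p0 y) < e" if "p \<in> cball p0 (min \<rho> (d/2))" "y \<in> K" for p y
      using d(2)[of "(p0, y)" "(p, y)"] that \<rho>(1) d(1) by (simp add: dist_Pair_Pair dist_commute)
    then show ?thesis using d(1) \<rho>(1) by (intro exI[of _ "min \<rho> (d/2)"]) auto
  qed
  have gap: "\<exists>m>0. \<forall>y\<in>K - B. m \<le> dist (f p0 y) q0" if B: "open B" "y0 \<in> B" for B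
  proof -
    have "compact (f p0 ` (K - B))"
      using cp[OF S(2)] K(1) B(1) by (meson Diff_subset compact_continuous_image compact_diff continuous_on_subset)
    moreover have "q0 \<notin> f p0 ` (K - B)" using single B(2) by blast
    ultimately show ?thesis
      using separate_point_closed[of "f p0 ` (K - B)" q0] compact_imp_closed by (auto simp: dist_commute)
  qed
  obtain m where m: "m > 0" "\<And>y. y \<in> K - ball y0 r \<Longrightarrow> m \<le> dist (f p0 y) q0"
    using gap[of "ball y0 r"] r(1) by auto
  obtain \<delta>1 where \<delta>1: "\<delta>1 > 0" "\<delta>1 \<le> \<rho>" "\<And>p y. p \<in> cball p0 \<delta>1 \<Longrightarrow> y \<in> K \<Longrightarrow> dist (f p y) (f p0 y) < m/4"
    using near[of "m/4"] m(1) by auto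
  \<comment> \<open>On the sphere bounding \<open>K\<close>, \<open>f p\<close> stays at least
    \<open>3/4 * m\<close> from \<open>q0\<close>, so the preimage of \<open>D\<close> avoids the
    sphere. On \<open>C\<close> below, two errors of \<open>m/4\<close> still lead into
    \<open>D\<close>.\<close>
  define D where "D = ball q0 (m/2)"
  have "continuous_on (ball y0 r) (f p0)"
    using cp[OF S(2)] unfolding K_def by (meson ball_subset_cball continuous_on_subset)
  then have "open (ball y0 r \<inter> f p0 -` ball q0 (m/4))" by (intro continuous_open_preimage) auto
  moreover have "y0 \<in> ball y0 r \<inter> f p0 -` ball q0 (m/4)" using r(1) m(1) by (simp add: q0_def)
  ultimately obtain s where s: "s > 0" "ball y0 s \<subseteq> ball y0 r \<inter> f p0 -` ball q0 (m/4)"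
    using open_contains_ball by blast
  define C where "C = ball y0 s"
  \<comment> \<open>The second gap forces every solution of \<open>f p y = q0\<close> in
    \<open>K\<close> into \<open>C\<close>.\<close>
  obtain m' where m': "m' > 0" "\<And>y. y \<in> K - C \<Longrightarrow> m' \<le> dist (f p0 y) q0"
    using gap[of C] s(1) by (auto simp: C_def)
  obtain \<delta>2 where \<delta>2: "\<delta>2 > 0" "\<delta>2 \<le> \<rho>" "\<And>p y. p \<in> cball p0 \<delta>2 \<Longrightarrow> y \<in> K \<Longrightarrow> dist (f p y) (f p0 y) < m'"
    using near[of m'] m'(1) by auto
  define \<delta> where "\<delta> = min \<delta>1 \<delta>2"
  have \<delta>: "\<delta> > 0" "cball p0 \<delta> \<subseteq> cball p0 \<delta>1" "cball p0 \<delta> \<subseteq> cball p0 \<delta>2" "cball p0 \<delta> \<subseteq> S"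
    using \<delta>1(1,2) \<delta>2(1) \<rho>(2) subset_cball[of \<delta> \<rho> p0] by (auto simp: \<delta>_def)
  have ex1: "\<exists>!y. y \<in> K \<and> f p y = q0" if p: "p \<in> cball p0 \<delta>" for p
  proof -
    have pS: "p \<in> S" and p1: "p \<in> cball p0 \<delta>1" and p2: "p \<in> cball p0 \<delta>2" using p \<delta> by blast+
    have CK: "C \<subseteq> K \<inter> f p -` D"
    proof
      fix y assume "y \<in> C"
      then have y: "y \<in> K" "dist (f p0 y) q0 < m/4"
        using s(2) ball_subset_cball unfolding C_def K_def by (auto simp: dist_commute subset_iff)
      have "dist (f p y) q0 < m/2" using \<delta>1(3)[OF p1 y(1)] y(2) dist_triangle[of "f p y" q0 "f p0 y"] by linarith
      then show "y \<in> K \<inter> f p -` D" using y(1) by (simp add: D_def dist_commute)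
    qed
    have inC: "y \<in> C" if "y \<in> K" "f p y = q0" for y
      using m'(2)[of y] \<delta>2(3)[OF p2, of y] that by (auto simp: dist_commute)
    have eq: "K \<inter> f p -` D = ball y0 r \<inter> f p -` D"
    proof -
      have "y \<in> ball y0 r" if "y \<in> K" "f p y \<in> D" for y
      proof (rule ccontr)
        assume "y \<notin> ball y0 r"
        then have "m \<le> dist (f p0 y) q0" using m(2) that by blast
        moreover have "dist (f p y) q0 < m/2" using that by (simp add: D_def dist_commute)
        ultimately show False
          using \<delta>1(3)[OF p1 that(1)] m(1) dist_triangle[of "f p0 y" q0 "f p y"] by (simp add: dist_commute)
      qed
      then show ?thesis unfolding K_def by auto
    qed
    have cov: "covering_space (K \<inter> f p -` D) (f p) D"
    proof (rule proper_local_injection_covering[OF K(1) cp[OF pS]])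
      have "continuous_on (ball y0 r) (f p)"
        using cp[OF pS] unfolding K_def by (meson ball_subset_cball continuous_on_subset)
      then show "open (K \<inter> f p -` D)" unfolding eq by (intro continuous_open_preimage) (auto simp: D_def)
      show "K \<inter> f p -` D \<noteq> {}" using CK s(1) unfolding C_def by (metis centre_in_ball empty_iff subsetD)
    qed (use inj pS K in \<open>auto simp: D_def\<close>)
    have "q0 \<in> D" using m(1) by (simp add: D_def)
    then have "q0 \<in> f p ` (K \<inter> f p -` D)" using covering_space_imp_surjective[OF cov] by simp
    then obtain y where y: "y \<in> K" "f p y = q0" by auto
    have "inj_on (f p) C"
      using CK by (intro covering_space_inj_on_connected[OF cov])
        (auto simp: D_def C_def convex_imp_locally_path_connected convex_imp_simply_connected)
    then show ?thesis using y inC unfolding inj_on_def by metis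
  qed
  define \<phi> where "\<phi> p = (THE y. y \<in> K \<and> f p y = q0)" for p
  have \<phi>: "\<phi> p \<in> K \<and> f p (\<phi> p) = q0" if "p \<in> cball p0 \<delta>" for p
    unfolding \<phi>_def using theI'[OF ex1[OF that]] .
  have uniq: "y = \<phi> p" if "p \<in> cball p0 \<delta>" "y \<in> K" "f p y = q0" for p y
    using ex1[OF that(1)] \<phi>[OF that(1)] that(2,3) by blast
  have "continuous_on (cball p0 \<delta>) \<phi>"
  proof (rule continuous_from_closed_graph[OF K(1)])
    show "\<phi> \<in> cball p0 \<delta> \<rightarrow> K" using \<phi> by blast
    have "(\<lambda>p. (p, \<phi> p)) ` cball p0 \<delta> = (cball p0 \<delta> \<times> K) \<inter> (\<lambda>(p, y). f p y) -` {q0}"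
      using \<phi> uniq by (auto simp: image_iff)
    moreover have "closed \<dots>"
      using \<delta>(4) K by (intro continuous_closed_preimage continuous_on_subset[OF cont] closed_Times compact_imp_closed) auto
    ultimately show "closed ((\<lambda>p. (p, \<phi> p)) ` cball p0 \<delta>)" by simp
  qed
  moreover have "\<phi> p0 = y0" using \<phi>[of p0] single \<delta>(1) by simp
  ultimately show ?thesis using that[of \<delta> \<phi>] \<delta> \<phi> K(2) unfolding q0_def by blast
qed

subsection \<open>Peano's existence theorem\<close>

text \<open>
  The delayed time \<open>d t\<close> is moved towards \<open>t0\<close> by \<open>h\<close>, so that the integral equation
  determines the solution on \<open>|t - t0| \<le> (n + 1) h\<close> from its values on \<open>|t - t0| \<le> n h\<close>,
  on both sides of \<open>t0\<close>.
\<close>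

lemma delay_ode_solution:
  fixes \<psi> :: "real \<times> 'b::euclidean_space \<Rightarrow> 'b" and t0 :: real
  assumes cont: "continuous_on UNIV \<psi>" and h: "h > 0"
  defines "d \<equiv> \<lambda>t. t - max (- h) (min h (t - t0))"
  obtains x where "x t0 = x0"
    "\<And>t. t \<in> {t0 - 1..t0 + 1} \<Longrightarrow> (x has_vector_derivative \<psi> (t, x (d t))) (at t within {t0 - 1..t0 + 1})"
proof -
  let ?T = "{t0 - 1..t0 + 1}"
  have dT: "d t \<in> ?T" if "t \<in> ?T" for t
    using that h unfolding d_def by (auto simp: max_def min_def)
  have cd: "continuous_on ?T d" unfolding d_def by (intro continuous_intros)
  have anti: "\<exists>x. x t0 = x0 \<and> (\<forall>t\<in>?T. (x has_vector_derivative \<psi> (t, y (d t))) (at t within ?T))"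
    if y: "continuous_on ?T y" for y
  proof -
    have "continuous_on ?T (\<lambda>t. \<psi> (t, y (d t)))"
      using dT by (intro continuous_on_compose2[OF cont] continuous_on_Pair continuous_on_id
          continuous_on_compose2[OF y cd]) auto
    then obtain g where g: "\<And>t. t \<in> ?T \<Longrightarrow> (g has_vector_derivative \<psi> (t, y (d t))) (at t within ?T)"
      using antiderivative_continuous by blast
    have "((\<lambda>t. g t + (x0 - g t0)) has_vector_derivative \<psi> (t, y (d t))) (at t within ?T)" if "t \<in> ?T" for t
      using g[OF that] has_vector_derivative_add_const by blast
    then show ?thesis by (intro exI[of _ "\<lambda>t. g t + (x0 - g t0)"]) auto
  qed
  have cx: "continuous_on ?T x"
    if "\<forall>t\<in>?T. (x has_vector_derivative \<psi> (t, y (d t))) (at t within ?T)" for x y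
    using that has_vector_derivative_continuous unfolding continuous_on_eq_continuous_within by blast
  have "\<exists>x y. x t0 = x0 \<and> (\<forall>t\<in>?T. (x has_vector_derivative \<psi> (t, y (d t))) (at t within ?T)) \<and>
      (\<forall>t\<in>?T. \<bar>t - t0\<bar> \<le> real n * h \<longrightarrow> x t = y t)" for n
  proof (induction n)
    case 0
    \<comment> \<open>For \<open>n = 0\<close> agreement is required only at \<open>t0\<close>, so
      the constant history \<open>x0\<close> will do.\<close>
    show ?case using anti[of "\<lambda>_. x0"] by fastforce
  next
    case (Suc n)
    then obtain x y where xy: "x t0 = x0" "\<forall>t\<in>?T. (x has_vector_derivative \<psi> (t, y (d t))) (at t within ?T)"
      "\<And>t. t \<in> ?T \<Longrightarrow> \<bar>t - t0\<bar> \<le> real n * h \<Longrightarrow> x t = y t" by blast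
    obtain z where z: "z t0 = x0" "\<forall>t\<in>?T. (z has_vector_derivative \<psi> (t, x (d t))) (at t within ?T)"
      using anti[OF cx[OF xy(2)]] by blast
    define J where "J = ?T \<inter> cball t0 (real (Suc n) * h)"
    \<comment> \<open>On \<open>J\<close> the delayed time falls where \<open>x\<close> and
      \<open>y\<close> already agree, so \<open>x\<close> and \<open>z\<close> have the same
      derivative there.\<close>
    have "z t - x t = z t0 - x t0" if t: "t \<in> J" for t
    proof (rule has_derivative_zero_unique[where s = J])
      show "convex J" unfolding J_def by (intro convex_Int) auto
      show "t0 \<in> J" using h by (simp add: J_def)
      fix s assume s: "s \<in> J"
      then have sT: "s \<in> ?T" and "\<bar>s - t0\<bar> \<le> real n * h + h"
        by (auto simp: J_def dist_real_def algebra_simps)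
      then have "\<bar>d s - t0\<bar> \<le> real n * h"
        using h unfolding d_def by (auto simp: max_def min_def abs_le_iff)
      then have "x (d s) = y (d s)" using xy(3) dT sT by blast
      then have "((\<lambda>t. z t - x t) has_vector_derivative 0) (at s within ?T)"
        using has_vector_derivative_diff[of z _ "at s within ?T" x] z(2) xy(2) sT by fastforce
      then show "((\<lambda>t. z t - x t) has_derivative (\<lambda>h. 0)) (at s within J)"
        unfolding has_vector_derivative_def J_def by (auto intro: has_derivative_subset)
    qed (fact t)
    then have "z t = x t" if "t \<in> ?T" "\<bar>t - t0\<bar> \<le> real (Suc n) * h" for t
      using that z(1) xy(1) by (force simp: J_def dist_real_def)
    then show ?case using z by blast
  qed
  \<comment> \<open>Finitely many delays exhaust the interval, and there \<open>x\<close> becomes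
    its own history.\<close>
  moreover obtain n where "1 < real n * h" using reals_Archimedean3[OF h] by blast
  ultimately obtain x y where xy: "x t0 = x0" "\<forall>t\<in>?T. (x has_vector_derivative \<psi> (t, y (d t))) (at t within ?T)"
      "\<And>t. t \<in> ?T \<Longrightarrow> \<bar>t - t0\<bar> \<le> real n * h \<Longrightarrow> x t = y t" by metis
  have "x t = y t" if "t \<in> ?T" for t using xy(3)[OF that] that \<open>1 < real n * h\<close> by auto
  then show ?thesis using that[of x] xy dT by metis
qed

lemma has_vector_derivative_lipschitz:
  assumes "convex S" "\<And>t. t \<in> S \<Longrightarrow> (x has_vector_derivative x' t) (at t within S)"
    and "\<And>t. norm (x' t) \<le> M" and "s \<in> S" "t \<in> S"
  shows "norm (x s - x t) \<le> M * \<bar>s - t\<bar>"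
  unfolding real_norm_def[symmetric]
proof (rule differentiable_bound[OF assms(1)])
  fix t assume "t \<in> S"
  then show "(x has_derivative (\<lambda>u. u *\<^sub>R x' t)) (at t within S)"
    using assms(2) unfolding has_vector_derivative_def by blast
  show "onorm (\<lambda>u. u *\<^sub>R x' t) \<le> M"
    using order_trans[OF norm_ge_zero assms(3)] assms(3)[of t]
    by (intro onorm_bound) (simp_all add: mult.commute[of M] mult_left_mono)
qed (use assms in auto)

text \<open>Solutions with delays tending to 0 are all \<open>M\<close>-Lipschitz, so Arzela-Ascoli
  gives a uniform limit \<open>g\<close> of a subsequence. A delay \<open>h\<close> displaces the
  argument of \<open>\<psi>\<close> by at most \<open>M * h\<close>, hence the derivatives converge
  uniformly to \<open>\<psi> (t, g t)\<close>.\<close>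

lemma peano_bounded:
  fixes \<psi> :: "real \<times> 'b::euclidean_space \<Rightarrow> 'b"
  assumes cont: "continuous_on UNIV \<psi>" and M: "\<And>z. norm (\<psi> z) \<le> M"
  obtains x where "x t0 = x0"
    "\<And>t. t \<in> {t0 - 1..t0 + 1} \<Longrightarrow> (x has_vector_derivative \<psi> (t, x t)) (at t within {t0 - 1..t0 + 1})"
proof -
  let ?T = "{t0 - 1..t0 + 1}"
  define h where "h k = inverse (real (Suc k))" for k
  define d where "d k t = t - max (- h k) (min (h k) (t - t0))" for k t
  have h: "h k > 0" for k by (simp add: h_def)
  have h0: "h \<longlonglongrightarrow> 0" unfolding h_def using LIMSEQ_inverse_real_of_nat .
  have dT: "d k t \<in> ?T" "\<bar>d k t - t\<bar> \<le> h k" if "t \<in> ?T" for k t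
    using that h[of k] unfolding d_def by (auto simp: max_def min_def)
  have M0: "M \<ge> 0" by (rule order_trans[OF norm_ge_zero M])
  have "\<exists>x. x t0 = x0 \<and> (\<forall>t\<in>?T. (x has_vector_derivative \<psi> (t, x (d k t))) (at t within ?T))" for k
    by (rule delay_ode_solution[OF cont h[of k], of t0 x0]) (auto simp: d_def)
  then obtain X where X0: "\<And>k. X k t0 = x0"
    and X: "\<And>k t. t \<in> ?T \<Longrightarrow> (X k has_vector_derivative \<psi> (t, X k (d k t))) (at t within ?T)"
    by metis
  have lip: "norm (X k s - X k t) \<le> M * \<bar>s - t\<bar>" if "s \<in> ?T" "t \<in> ?T" for k s t
    using has_vector_derivative_lipschitz[of ?T "X k", OF _ X M that] by simp
  have XK: "X k t \<in> cball x0 M" if "t \<in> ?T" for k t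
  proof -
    have "norm (X k t - X k t0) \<le> M * \<bar>t - t0\<bar>" using lip that by auto
    also have "\<dots> \<le> M * 1" using M0 that by (intro mult_left_mono) auto
    finally show ?thesis using X0 by (simp add: dist_norm norm_minus_commute)
  qed
  obtain g \<kappa> where \<kappa>: "strict_mono (\<kappa> :: nat \<Rightarrow> nat)"
    and g: "\<And>e. 0 < e \<Longrightarrow> \<exists>N. \<forall>n x. n \<ge> N \<and> x \<in> ?T \<longrightarrow> norm (X (\<kappa> n) x - g x) < e"
  proof (rule Arzela_Ascoli[of ?T X "norm x0 + M"])
    show "norm (X n t) \<le> norm x0 + M" if "t \<in> ?T" for n t
    proof -
      have "norm (X n t - x0) \<le> M" using XK[OF that] by (simp add: dist_norm norm_minus_commute)
      then show ?thesis using norm_triangle_sub[of "X n t" x0] by linarith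
    qed
    show "\<exists>d>0. \<forall>n s. s \<in> ?T \<and> norm (t - s) < d \<longrightarrow> norm (X n t - X n s) < e" if "t \<in> ?T" "0 < e" for t e
    \<comment> \<open>\<open>M + 1\<close> avoids division by zero when
      \<open>M = 0\<close>.\<close>
    proof (intro exI[of _ "e / (M + 1)"] conjI allI impI)
      show "0 < e / (M + 1)" using that M0 by simp
      fix n s assume s: "s \<in> ?T \<and> norm (t - s) < e / (M + 1)"
      have "norm (X n t - X n s) \<le> M * \<bar>t - s\<bar>" using lip s that by blast
      also have "\<dots> \<le> (M + 1) * \<bar>t - s\<bar>" by (simp add: algebra_simps)
      also have "\<dots> < e" using s M0 by (simp add: field_simps)
      finally show "norm (X n t - X n s) < e" .
    qed
  qed auto
  have lim: "(\<lambda>n. X (\<kappa> n) t) \<longlonglongrightarrow> g t" if "t \<in> ?T" for t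
    unfolding LIMSEQ_iff using g that by blast
  have gK: "g t \<in> cball x0 M" if "t \<in> ?T" for t
    using closed_sequentially[OF closed_cball _ lim[OF that]] XK[OF that] by blast
  have uc: "uniformly_continuous_on (?T \<times> cball x0 M) \<psi>"
    by (intro compact_uniformly_continuous continuous_on_subset[OF cont] compact_Times) auto
  \<comment> \<open>Differentiating the sequence termwise yields some limit \<open>y\<close>, which
    is identified with \<open>g\<close> afterwards by uniqueness of limits.\<close>
  have "\<exists>y. \<forall>t\<in>?T. (\<lambda>n. X (\<kappa> n) t) \<longlonglongrightarrow> y t \<and> (y has_derivative (\<lambda>u. u *\<^sub>R \<psi> (t, g t))) (at t within ?T)"
  proof (rule has_derivative_sequence[where f' = "\<lambda>n t u. u *\<^sub>R \<psi> (t, X (\<kappa> n) (d (\<kappa> n) t))"])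
    show "(X (\<kappa> n) has_derivative (\<lambda>u. u *\<^sub>R \<psi> (t, X (\<kappa> n) (d (\<kappa> n) t)))) (at t within ?T)"
      if "t \<in> ?T" for n t
      using X[OF that] unfolding has_vector_derivative_def .
    show "(\<lambda>n. X (\<kappa> n) t0) \<longlonglongrightarrow> x0" using X0 by simp
    fix e :: real assume e: "e > 0"
    obtain \<eta> where \<eta>: "\<eta> > 0" "\<And>u v. u \<in> ?T \<times> cball x0 M \<Longrightarrow> v \<in> ?T \<times> cball x0 M \<Longrightarrow>
        dist v u < \<eta> \<Longrightarrow> dist (\<psi> v) (\<psi> u) < e"
      using uc e unfolding uniformly_continuous_on_def by metis
    obtain N where N: "\<And>n t. n \<ge> N \<Longrightarrow> t \<in> ?T \<Longrightarrow> norm (X (\<kappa> n) t - g t) < \<eta> / 2"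
      using g[of "\<eta> / 2"] \<eta>(1) by auto
    have "(\<lambda>n. M * h (\<kappa> n)) \<longlonglongrightarrow> M * 0"
      using LIMSEQ_subseq_LIMSEQ[OF h0 \<kappa>] by (intro tendsto_mult_left) (simp add: o_def)
    then have "\<forall>\<^sub>F n in sequentially. M * h (\<kappa> n) < \<eta> / 2"
      using \<eta>(1) by (intro order_tendstoD(2)) auto
    then show "\<forall>\<^sub>F n in sequentially. \<forall>t\<in>?T. \<forall>u. norm (u *\<^sub>R \<psi> (t, X (\<kappa> n) (d (\<kappa> n) t)) - u *\<^sub>R \<psi> (t, g t)) \<le> e * norm u"
      using eventually_ge_at_top[of N]
    proof eventually_elim
      case (elim n)
      have "norm (\<psi> (t, X (\<kappa> n) (d (\<kappa> n) t)) - \<psi> (t, g t)) \<le> e" if t: "t \<in> ?T" for t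
      proof -
        have "norm (X (\<kappa> n) (d (\<kappa> n) t) - X (\<kappa> n) t) \<le> M * \<bar>d (\<kappa> n) t - t\<bar>"
          using lip dT(1)[OF t] t by blast
        also have "\<dots> \<le> M * h (\<kappa> n)" using dT(2)[OF t] M0 by (rule mult_left_mono)
        also have "\<dots> < \<eta> / 2" by (fact elim(1))
        finally have "dist (X (\<kappa> n) (d (\<kappa> n) t)) (g t) < \<eta>"
          using N[OF elim(2) t] dist_triangle_half_r[of "X (\<kappa> n) t"] by (simp add: dist_norm norm_minus_commute)
        then show ?thesis
          using \<eta>(2)[of "(t, g t)" "(t, X (\<kappa> n) (d (\<kappa> n) t))"] t gK[OF t] XK[OF dT(1)[OF t]]
          by (simp add: dist_Pair_Pair dist_norm less_imp_le)
      qed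
      then show ?case
        by (auto simp: scaleR_diff_right[symmetric] mult.commute[of e] intro: mult_left_mono)
    qed
  qed auto
  then obtain y where y: "\<And>t. t \<in> ?T \<Longrightarrow> (\<lambda>n. X (\<kappa> n) t) \<longlonglongrightarrow> y t"
    "\<And>t. t \<in> ?T \<Longrightarrow> (y has_vector_derivative \<psi> (t, g t)) (at t within ?T)"
    unfolding has_vector_derivative_def by blast
  have "y t = g t" if "t \<in> ?T" for t using LIMSEQ_unique y(1) lim that by blast
  moreover have "y t0 = x0" using y(1)[of t0] X0 by (simp add: LIMSEQ_const_iff)
  ultimately show ?thesis using that[of y] y(2) by auto
qed

text \<open>Composition with the nearest-point projection onto the ball extends
  \<open>\<phi>\<close> to a bounded continuous map on the whole space. A solution for the extension
  remains in the ball for a short time, and there the two maps agree.\<close>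

theorem peano_existence:
  fixes \<phi> :: "real \<times> 'b::euclidean_space \<Rightarrow> 'b"
  assumes \<delta>: "\<delta> > 0" and cont: "continuous_on (cball (t0, x0) \<delta>) \<phi>"
  obtains \<epsilon> x where "\<epsilon> > 0" "x t0 = x0"
    "\<And>t. t \<in> {t0 - \<epsilon><..<t0 + \<epsilon>} \<Longrightarrow> (t, x t) \<in> cball (t0, x0) \<delta> \<and> (x has_vector_derivative \<phi> (t, x t)) (at t)"
proof -
  define K where "K = cball (t0, x0) \<delta>"
  have K: "closed K" "convex K" "K \<noteq> {}" "compact K" using \<delta> by (auto simp: K_def)
  define \<psi> where "\<psi> z = \<phi> (closest_point K z)" for z
  have cp: "closest_point K z \<in> K" for z using closest_point_in_set K by blast
  have c\<psi>: "continuous_on UNIV \<psi>"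
    unfolding \<psi>_def using cp K
    by (intro continuous_on_compose2[OF cont] continuous_on_closest_point) (auto simp: K_def)
  have "bounded (\<phi> ` K)" using cont K(4) by (simp add: K_def compact_continuous_image compact_imp_bounded)
  then obtain M where M: "\<And>z. norm (\<psi> z) \<le> M" unfolding bounded_iff \<psi>_def using cp by blast
  have M0: "M \<ge> 0" by (rule order_trans[OF norm_ge_zero M])
  let ?T = "{t0 - 1..t0 + 1}"
  obtain x where x: "x t0 = x0" "\<And>t. t \<in> ?T \<Longrightarrow> (x has_vector_derivative \<psi> (t, x t)) (at t within ?T)"
    using peano_bounded[OF c\<psi> M] by blast
  have lip: "norm (x t - x t0) \<le> M * \<bar>t - t0\<bar>" if "t \<in> ?T" for t
    using has_vector_derivative_lipschitz[of ?T x, OF _ x(2) M that, of t0] by simp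
  \<comment> \<open>The solution lives on an interval of radius 1, and its graph leaves
    \<open>(t0, x0)\<close> with speed at most \<open>M + 1\<close>: 1 for the time and
    \<open>M\<close> for the value.\<close>
  define \<epsilon> where "\<epsilon> = min 1 (\<delta> / (M + 1))"
  have \<epsilon>: "\<epsilon> > 0" "\<epsilon> \<le> 1" using \<delta> M0 by (auto simp: \<epsilon>_def)
  have "(t, x t) \<in> K \<and> (x has_vector_derivative \<phi> (t, x t)) (at t)" if t: "t \<in> {t0 - \<epsilon><..<t0 + \<epsilon>}" for t
  proof -
    have tT: "t \<in> ?T" and "t \<in> interior ?T" using t \<epsilon> by auto
    have "dist (t, x t) (t0, x0) \<le> \<bar>t - t0\<bar> + M * \<bar>t - t0\<bar>"
      using lip[OF tT] sqrt_sum_squares_le_sum[of "dist t t0" "dist (x t) x0"] x(1)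
      unfolding dist_Pair_Pair by (simp add: dist_norm)
    also have "\<dots> = (M + 1) * \<bar>t - t0\<bar>" by (simp add: algebra_simps)
    also have "\<dots> \<le> (M + 1) * (\<delta> / (M + 1))"
      using t M0 by (intro mult_left_mono) (auto simp: \<epsilon>_def)
    also have "\<dots> = \<delta>" using M0 by simp
    finally have tK: "(t, x t) \<in> K" by (simp add: K_def dist_commute)
    have "(x has_vector_derivative \<psi> (t, x t)) (at t)"
      using x(2)[OF tT] at_within_interior[OF \<open>t \<in> interior ?T\<close>] by simp
    then show ?thesis using tK closest_point_self[OF tK] by (simp add: \<psi>_def)
  qed
  then show ?thesis using that[of \<epsilon> x] \<epsilon>(1) x(1) unfolding K_def by blast
qed

section \<open>Reduction of the implicit equation to an explicit one\<close>

theorem corollary4p3: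
  fixes I :: "real set" and V W :: "(real ^ 'n) set"
    and t0 :: real and x0 y0 :: "real ^ 'n"
    and F :: "real \<times> (real ^ 'n) \<times> (real ^ 'n) \<Rightarrow> real ^ 'n"
  assumes "open I" and "open V" and "open W"
    and "(t0, x0, y0) \<in> I \<times> V \<times> W"
    and "continuous_on (I \<times> V \<times> W) F"
    and "F (t0, x0, y0) = 0"
    and "\<And>t x. t \<in> I \<Longrightarrow> x \<in> V \<Longrightarrow> (\<lambda>y. F (t, x, y)) differentiable_on W"
    and "\<And>t x y. t \<in> I \<Longrightarrow> x \<in> V \<Longrightarrow> \<not> critical_point_on (\<lambda>y. F (t, x, y)) W y"
  shows "\<exists>\<epsilon>>0. \<exists>x. implicit_ode_solution F I V W t0 x0 y0 \<epsilon> x"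
proof -
  let ?f = "\<lambda>p y. F (fst p, snd p, y)"
  have mem: "t0 \<in> I" "x0 \<in> V" "y0 \<in> W" using assms(4) by auto
  have cont: "continuous_on ((I \<times> V) \<times> W) (\<lambda>(p, y). ?f p y)"
    unfolding case_prod_beta
    by (rule continuous_on_compose2[OF assms(5)]) (auto intro!: continuous_intros)
  have inj: "\<exists>N. open N \<and> y \<in> N \<and> inj_on (?f p) N" if p: "p \<in> I \<times> V" and y: "y \<in> W" for p y
  proof -
    have pm: "fst p \<in> I" "snd p \<in> V" using p by auto
    have "(?f p has_derivative frechet_derivative (?f p) (at z)) (at z)" if "z \<in> W" for z
      using assms(7)[OF pm] that assms(3) frechet_derivative_works
      unfolding differentiable_on_eq_differentiable_at[OF assms(3)] by blast
    moreover have "inj (frechet_derivative (?f p) (at z))" if "z \<in> W" for z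
      using assms(8)[OF pm, of z] that unfolding critical_point_on_def by (simp add: bij_is_inj)
    ultimately have "\<exists>N. open N \<and> y \<in> N \<and> N \<subseteq> W \<and> inj_on (?f p) N"
      by (rule everywhere_nonsingular_locally_injective[OF assms(3) _ _ y])
    then show ?thesis by blast
  qed
  \<comment> \<open>With \<open>(t, x)\<close> as parameter, the equation is solved for the
    derivative: solutions of \<open>x' = \<phi> (t, x)\<close> satisfy the implicit
    equation.\<close>
  obtain \<delta> \<phi> where \<delta>: "\<delta> > 0" "cball (t0, x0) \<delta> \<subseteq> I \<times> V" "continuous_on (cball (t0, x0) \<delta>) \<phi>"
    and \<phi>: "\<phi> (t0, x0) = y0"
      "\<And>p. p \<in> cball (t0, x0) \<delta> \<Longrightarrow> \<phi> p \<in> W \<and> ?f p (\<phi> p) = ?f (t0, x0) y0"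
    by (rule implicit_function_locally_injective[OF open_Times[OF assms(1,2)] _ assms(3) mem(3) cont inj, of "(t0, x0)"])
      (use mem in auto)
  obtain \<epsilon> x where x: "\<epsilon> > 0" "x t0 = x0"
    "\<And>t. t \<in> {t0 - \<epsilon><..<t0 + \<epsilon>} \<Longrightarrow>
      (t, x t) \<in> cball (t0, x0) \<delta> \<and> (x has_vector_derivative \<phi> (t, x t)) (at t)"
    using peano_existence[OF \<delta>(1,3)] by blast
  have "implicit_ode_solution F I V W t0 x0 y0 \<epsilon> x"
    unfolding implicit_ode_solution_def
  proof (intro conjI ballI)
    fix t assume t: "t \<in> {t0 - \<epsilon><..<t0 + \<epsilon>}"
    have tx: "(t, x t) \<in> cball (t0, x0) \<delta>" and d: "(x has_vector_derivative \<phi> (t, x t)) (at t)"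
      using x(3)[OF t] by auto
    have vd: "vector_derivative x (at t) = \<phi> (t, x t)" using d by (rule vector_derivative_at)
    show "x differentiable (at t)" using d by (rule differentiableI_vector)
    show "(t, x t, vector_derivative x (at t)) \<in> I \<times> V \<times> W"
      using \<delta>(2) tx \<phi>(2)[OF tx] unfolding vd by blast
    show "F (t, x t, vector_derivative x (at t)) = 0" using \<phi>(2)[OF tx] assms(6) unfolding vd by simp
  next
    show "x t0 = x0" by (fact x(2))
    \<comment> \<open>The prescribed initial derivative comes from the normalization of
      \<open>\<phi>\<close> at \<open>(t0, x0)\<close>.\<close>
    show "vector_derivative x (at t0) = y0"
      using vector_derivative_at[of x "\<phi> (t0, x t0)" t0] x(1,2) x(3)[of t0] \<phi>(1) by simp
  qed
  then show ?thesis using x(1) by blast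
qed

end
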